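(* Let $q\ge2$, and let $t,n$ be positive integers with $t\ge3$ and $2\le n<\frac{15+\sqrt{33}}{24}(t-1)^2$. Then $m_q(n,t)\le n$.
   Context: Let $Q=\{0,1,\dots,q-1\}$. For a nonempty set $X=\{\mathbf c^1,\dots,\mathbf c^s\}\subseteq Q^n$, a position $i\in[n]$ is undetectable for $X$ if $c^1_i=\dots=c^s_i$; let $U(X)$ be the set of undetectable positions and $\mathrm{wdesc}(X)=\{\mathbf y\in Q^n: y_i=c^1_i \text{ for all } i\in U(X)\}$. For $t\ge2$, a code $\mathcal C\subseteq Q^n$ is a wide-sense $t$-frameproof code if $\mathrm{wdesc}(X)\cap\mathcal C=X$ for every nonempty $X\subseteq\mathcal C$ with $|X|\le t$. $m_q(n,t)$ is the maximum size of a wide-sense $t$-frameproof code in $Q^n$. *)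

theory Defs
  imports Complex_Main "HOL-Library.FuncSet"
begin

definition words :: "nat \<Rightarrow> nat \<Rightarrow> (nat \<Rightarrow> nat) set" where
  "words q n = {1..n} \<rightarrow>\<^sub>E {0..<q}"

definition undetectable :: "nat \<Rightarrow> (nat \<Rightarrow> nat) set \<Rightarrow> nat set" where
  "undetectable n X = {i \<in> {1..n}. \<forall>c\<in>X. \<forall>d\<in>X. c i = d i}"

text \<open>On an undetectable position all members of X agree, so for nonempty X comparing with
  every member of X is the same as comparing with the first one.\<close>

definition wdesc :: "nat \<Rightarrow> nat \<Rightarrow> (nat \<Rightarrow> nat) set \<Rightarrow> (nat \<Rightarrow> nat) set" where
  "wdesc q n X = {y \<in> words q n. \<forall>i \<in> undetectable n X. \<forall>c\<in>X. y i = c i}"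

definition wide_sense_frameproof :: "nat \<Rightarrow> nat \<Rightarrow> nat \<Rightarrow> (nat \<Rightarrow> nat) set \<Rightarrow> bool" where
  "wide_sense_frameproof q n t C \<longleftrightarrow>
     C \<subseteq> words q n \<and>
     (\<forall>X. X \<noteq> {} \<and> X \<subseteq> C \<and> card X \<le> t \<longrightarrow> wdesc q n X \<inter> C = X)"

definition max_frameproof :: "nat \<Rightarrow> nat \<Rightarrow> nat \<Rightarrow> nat" where
  "max_frameproof q n t = Max (card ` {C. wide_sense_frameproof q n t C})"

text \<open>The maximum is taken over a finite nonempty set, and card X is the true cardinality,
  because there are only finitely many words.\<close>

lemma finite_words: "finite (words q n)"
  by (simp add: words_def finite_PiE)

lemma finite_frameproof_codes: "finite {C. wide_sense_frameproof q n t C}"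
  by (rule finite_subset[of _ "Pow (words q n)"])
    (auto simp: wide_sense_frameproof_def finite_words)

lemma wide_sense_frameproof_empty: "wide_sense_frameproof q n t {}"
  by (simp add: wide_sense_frameproof_def)

end

theory Submission
  imports Defs
begin

text \<open>Fix a codeword \<open>c\<^sub>0\<close> and replace every other codeword by the set of positions where it differs
  from \<open>c\<^sub>0\<close>. The frameproof property says that no such set is covered by \<open>d = t - 1\<close> others. For
  such a cover-free family with at least \<open>n\<close> members on \<open>n < c d\<^sup>2\<close> points, where
  \<open>c = (15 + \<surd>33) / 24\<close>, induction on \<open>n\<close> shows that it consists of all singletons: points lying in
  at most one set can be removed; a set with at least \<open>2 c d\<close> points can be removed together with
  its points, at the price of passing from \<open>d\<close> to \<open>d - 1\<close>; and otherwise the Erdos--Gallai bound on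
  graphs with small matching number gives every set more than \<open>(n - 1) / 2\<close>
  pairs of points contained in no other set, which is more than the total number of pairs allows.
  Hence a code with more than \<open>n\<close> words would have all its words at mutual distance one while, seen
  from \<open>c\<^sub>0\<close>, differing in distinct positions, which is impossible for \<open>n \<ge> 2\<close>.\<close>

section \<open>Matchings and the Erdos--Gallai bound\<close>

definition matching :: "'a set set \<Rightarrow> bool" where
  "matching M \<longleftrightarrow> pairwise disjnt M"

lemma card_Union_matching:
  assumes "matching M" "finite M" "\<And>e. e \<in> M \<Longrightarrow> card e = 2"
  shows "card (\<Union>M) = 2 * card M"
proof -
  have "card (\<Union>M) = sum card M"
    using assms by (intro card_Union_disjoint) (auto simp: matching_def intro: card_ge_0_finite)
  then show ?thesis using assms(3) by simp
qed

lemma matching_insert: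
  assumes "matching M" "e \<inter> \<Union>M = {}"
  shows "matching (insert e M)"
  using assms unfolding matching_def pairwise_insert disjnt_def by blast

lemma matching_subset: "matching M \<Longrightarrow> N \<subseteq> M \<Longrightarrow> matching N"
  unfolding matching_def by (rule pairwise_subset)

lemma matching_disjoint:
  "matching M \<Longrightarrow> e \<in> M \<Longrightarrow> f \<in> M \<Longrightarrow> e \<noteq> f \<Longrightarrow> e \<inter> f = {}"
  unfolding matching_def pairwise_def disjnt_def by blast

lemma card_pairs: "finite W \<Longrightarrow> 2 * card {e. e \<subseteq> W \<and> card e = 2} = card W * (card W - 1)"
  by (cases "card W") (simp_all add: n_subsets choose_two)

lemma doubletonE:
  assumes "card e = 2" "x \<in> e"
  obtains y where "e = {x, y}" "x \<noteq> y"
  using assms by (auto simp: card_2_iff)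

text \<open>Truncated subtraction does no harm here, because the product vanishes at n = 0.\<close>

lemma int_mult_pred: "int (n * (n - 1)) = int n * (int n - 1)"
  by (cases n) (auto simp: algebra_simps)

lemma pair_not_in: "y \<notin> \<Union>N \<Longrightarrow> {x, y} \<notin> N"
  by blast

text \<open>Let \<open>A\<close> be the set of endpoints of matching edges with at least two neighbours outside the
  matching, and \<open>A'\<close> the set of their partners. Since there is no augmenting path, \<open>A'\<close> is
  independent and has no neighbours outside. With \<open>p = |A|\<close> and \<open>m = |M|\<close>, the edges meeting \<open>A\<close>,
  those inside the matched vertices, and those leaving them number at most
  \<open>p D\<close>, \<open>(2 m - p choose 2) - (p choose 2)\<close>, and \<open>2 (m - p)\<close>.\<close>

lemma maximum_matching_edge_bound:
  fixes E :: "'a set set"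
  assumes V: "finite V" and E: "\<And>e. e \<in> E \<Longrightarrow> e \<subseteq> V \<and> card e = 2"
    and M: "M \<subseteq> E" "matching M"
    and max: "\<And>N. N \<subseteq> E \<Longrightarrow> matching N \<Longrightarrow> card N \<le> card M"
    and deg: "\<And>v. v \<in> V \<Longrightarrow> card {e \<in> E. v \<in> e} \<le> D"
    and D: "2 * card M \<le> D"
  shows "card E \<le> card M * (D + 1)"
proof -
  have finE: "finite E" using E V by (intro finite_subset[of E "Pow V"]) auto
  have finM: "finite M" using finite_subset[OF M(1) finE] .
  define W where "W = \<Union>M"
  have finW: "finite W" unfolding W_def using E M(1) V by (meson Sup_least finite_subset subsetD)
  have cM: "card e = 2" if "e \<in> M" for e using E M(1) that by blast
  have cW: "card W = 2 * card M" unfolding W_def using card_Union_matching[OF M(2) finM] cM by blast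
  define out where "out x = {y. y \<notin> W \<and> {x, y} \<in> E}" for x
  have outV: "out x \<subseteq> V" for x using E unfolding out_def by blast
  have finout: "finite (out x)" for x using outV V finite_subset by blast
  \<comment> \<open>Augmenting path s - x - y - r: the edge xy gives way to xs and yr.\<close>
  have aug1: False if "{x, y} \<in> M" "x \<noteq> y" "s \<in> out x" "r \<in> out y" "s \<noteq> r" for x y s r
  proof -
    let ?K = "M - {{x, y}}"
    have U: "\<Union>?K \<inter> {x, y} = {}" "\<Union>?K \<subseteq> W" "{x, y} \<subseteq> W"
      using matching_disjoint[OF M(2) that(1)] that(1) by (auto simp: W_def)
    have sr: "s \<notin> W" "r \<notin> W" "{x, s} \<in> E" "{y, r} \<in> E" using that by (auto simp: out_def)
    let ?N = "insert {x, s} (insert {y, r} ?K)"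
    have "matching (insert {y, r} ?K)"
      by (rule matching_insert[OF matching_subset[OF M(2) Diff_subset]]) (use U sr in auto)
    then have mN: "matching ?N"
      by (rule matching_insert) (use U sr that in auto)
    have "{y, r} \<notin> ?K" by (rule pair_not_in) (use U sr in auto)
    moreover have "{x, s} \<notin> insert {y, r} ?K" by (rule pair_not_in) (use U sr that in auto)
    ultimately have "card ?N = Suc (Suc (card ?K))" using finM by simp
    moreover have "card ?K = card M - 1" "card M > 0" using that(1) finM by (auto simp: card_gt_0_iff)
    ultimately have "card ?N > card M" by linarith
    moreover have "?N \<subseteq> E" using M(1) sr by blast
    ultimately show False using max[OF _ mN] by simp
  qed
  \<comment> \<open>Augmenting path s - x - y - y' - x' - r: the edges xy and x'y' give way to xs,
    yy' and x'r.\<close>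
  have aug2: False if e: "{x, y} \<in> M" "x \<noteq> y" and f: "{x', y'} \<in> M" "x' \<noteq> y'" "{x, y} \<noteq> {x', y'}"
    and o: "s \<in> out x" "r \<in> out x'" "s \<noteq> r" and yy: "{y, y'} \<in> E" for x y x' y' s r
  proof -
    let ?K = "M - {{x, y}, {x', y'}}"
    have U: "\<Union>?K \<inter> {x, y} = {}" "\<Union>?K \<inter> {x', y'} = {}" "\<Union>?K \<subseteq> W" "{x, y, x', y'} \<subseteq> W"
      using matching_disjoint[OF M(2) e(1)] matching_disjoint[OF M(2) f(1)] e(1) f(1)
      by (auto simp: W_def)
    have dj: "{x, y} \<inter> {x', y'} = {}" using matching_disjoint[OF M(2) e(1) f(1) f(3)] .
    have sr: "s \<notin> W" "r \<notin> W" "{x, s} \<in> E" "{x', r} \<in> E" using o by (auto simp: out_def)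
    let ?N1 = "insert {y, y'} ?K"
    let ?N2 = "insert {x', r} ?N1"
    let ?N = "insert {x, s} ?N2"
    have m1: "matching ?N1"
      by (rule matching_insert[OF matching_subset[OF M(2) Diff_subset]]) (use U in auto)
    have m2: "matching ?N2"
      by (rule matching_insert[OF m1]) (use U sr dj f in auto)
    have mN: "matching ?N"
      by (rule matching_insert[OF m2]) (use U sr dj e f o in auto)
    have "{y, y'} \<notin> ?K" using U by blast
    moreover have "{x', r} \<notin> ?N1" by (rule pair_not_in) (use U sr in auto)
    moreover have "{x, s} \<notin> ?N2" by (rule pair_not_in) (use U sr o in auto)
    ultimately have "card ?N = Suc (Suc (Suc (card ?K)))" using finM by simp
    moreover have "card ?K = card M - 2" using e(1) f finM
      by (subst card_Diff_subset) auto
    ultimately have "card ?N > card M" by linarith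
    moreover have "?N \<subseteq> E" using M(1) sr yy by blast
    ultimately show False using max[OF _ mN] by simp
  qed
  define MA where "MA = {e \<in> M. \<exists>u\<in>e. card (out u) \<ge> 2}"
  have MA: "MA \<subseteq> M" "finite MA" using finM by (auto simp: MA_def)
  have "\<forall>e\<in>MA. \<exists>u v. e = {u, v} \<and> u \<noteq> v \<and> card (out u) \<ge> 2"
  proof
    fix e assume "e \<in> MA"
    then obtain x where x: "x \<in> e" "card (out x) \<ge> 2" "card e = 2" using cM unfolding MA_def by blast
    obtain y where "e = {x, y}" "x \<noteq> y" using x(3,1) by (rule doubletonE)
    then show "\<exists>u v. e = {u, v} \<and> u \<noteq> v \<and> card (out u) \<ge> 2" using x(2) by blast
  qed
  then obtain u v where uv: "\<And>e. e \<in> MA \<Longrightarrow> e = {u e, v e} \<and> u e \<noteq> v e \<and> card (out (u e)) \<ge> 2"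
    by metis
  \<comment> \<open>Two outside neighbours are demanded of \<open>u e\<close> so that the two ends
    of an augmenting path can be chosen distinct.\<close>
  have pick: "\<exists>s\<in>out (u e). s \<noteq> r" if "e \<in> MA" for e r
  proof (rule ccontr)
    assume "\<not> ?thesis"
    then have "out (u e) \<subseteq> {r}" by blast
    then have "card (out (u e)) \<le> 1" using card_mono[of "{r}"] by fastforce
    then show False using uv[OF that] by linarith
  qed
  have uvin: "u e \<in> e" "v e \<in> e" "e \<in> M" if "e \<in> MA" for e using uv[OF that] MA(1) that by blast+
  have same: "e = f" if "e \<in> MA" "f \<in> MA" "x \<in> e" "x \<in> f" for e f x
    using matching_disjoint[OF M(2), of e f] uvin(3) that by blast
  have injA: "inj_on u MA" "inj_on v MA"
    using same uvin(1,2) by (metis inj_onI)+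
  define A where "A = u ` MA"
  define A' where "A' = v ` MA"
  define B where "B = \<Union>(M - MA)"
  define p where "p = card MA"
  define m where "m = card M"
  have pm: "p \<le> m" unfolding p_def m_def using card_mono[OF finM MA(1)] .
  have cA: "card A = p" "card A' = p" unfolding A_def A'_def p_def using injA by (auto intro: card_image)
  have AW: "A \<subseteq> W" "A' \<subseteq> W" unfolding A_def A'_def W_def using uvin by blast+
  have AA': "A \<inter> A' = {}"
  proof -
    have "u e \<noteq> v f" if "e \<in> MA" "f \<in> MA" for e f
    proof
      assume *: "u e = v f"
      have "e = f" using same[OF that uvin(1)[OF that(1)]] uvin(2)[OF that(2)] * by simp
      then show False using * uv[OF that(1)] by auto
    qed
    then show ?thesis by (auto simp: A_def A'_def)
  qed
  have WB: "W \<subseteq> A \<union> A' \<union> B"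
  proof
    fix x assume "x \<in> W"
    then obtain e where e: "e \<in> M" "x \<in> e" unfolding W_def by blast
    show "x \<in> A \<union> A' \<union> B"
    proof (cases "e \<in> MA")
      case True
      then have "x = u e \<or> x = v e" using e(2) uv by blast
      then show ?thesis unfolding A_def A'_def using True by blast
    next
      case False
      then show ?thesis unfolding B_def using e by blast
    qed
  qed
  have cB: "card B = 2 * (m - p)"
    unfolding B_def m_def p_def using card_Union_matching[of "M - MA"] M(2) finM cM MA
    by (simp add: card_Diff_subset matching_subset)
  have outB: "card (out x) \<le> 1" if x: "x \<in> B" for x
  proof -
    obtain e where "e \<in> M" "e \<notin> MA" "x \<in> e" using x unfolding B_def by blast
    then have "\<not> card (out x) \<ge> 2" unfolding MA_def by blast
    then show ?thesis by simp
  qed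
  have outA': "out x = {}" if x: "x \<in> A'" for x
  proof -
    obtain e where e: "e \<in> MA" "x = v e" using x A'_def by blast
    have False if r: "r \<in> out x" for r
    proof -
      obtain s where "s \<in> out (u e)" "s \<noteq> r" using pick[OF e(1)] by blast
      moreover have "{u e, v e} \<in> M" "u e \<noteq> v e" using uv[OF e(1)] e(1) MA(1) by auto
      ultimately show False using aug1 r e(2) by blast
    qed
    then show ?thesis by blast
  qed
  have indA': "False" if g: "g \<in> E" "g \<subseteq> A'" for g
  proof -
    obtain y y' where y: "g = {y, y'}" "y \<noteq> y'" using E[OF g(1)] by (auto simp: card_2_iff)
    obtain e f where ef: "e \<in> MA" "f \<in> MA" "y = v e" "y' = v f" using g(2) y A'_def by blast
    obtain r where r: "r \<in> out (u f)" using pick[OF ef(2)] by blast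
    obtain s where s: "s \<in> out (u e)" "s \<noteq> r" using pick[OF ef(1)] by blast
    have e1: "e = {u e, v e}" "u e \<noteq> v e" "f = {u f, v f}" "u f \<noteq> v f" using uv ef by blast+
    have "{u e, v e} \<noteq> {u f, v f}" using e1 y ef by metis
    moreover have "{u e, v e} \<in> M" "{u f, v f} \<in> M" using e1 ef MA(1) by auto
    ultimately show False using aug2[of "u e" "v e" "u f" "v f" s r] e1 r s g(1) y ef by blast
  qed
  define P where "P X = {e :: 'a set. e \<subseteq> X \<and> card e = 2}" for X
  have finP: "finite (P X)" if "finite X" for X
    unfolding P_def by (rule finite_subset[of _ "Pow X"]) (use that in auto)
  define E1 where "E1 = (\<Union>x\<in>A. {e \<in> E. x \<in> e})"
  define E2 where "E2 = P (W - A) - P A'"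
  define E3 where "E3 = (\<Union>x\<in>B. (\<lambda>y. {x, y}) ` out x)"
  have BW: "B \<subseteq> W" unfolding B_def W_def by blast
  have finAB: "finite A" "finite A'" "finite B" using AW BW finW finite_subset by blast+
  have sub: "E \<subseteq> E1 \<union> E2 \<union> E3"
  proof
    fix g assume g: "g \<in> E"
    show "g \<in> E1 \<union> E2 \<union> E3"
    proof (cases "g \<inter> A = {}")
      case False then show ?thesis using g unfolding E1_def by blast
    next
      case gA: True
      show ?thesis
      proof (cases "g \<subseteq> W")
        case True
        then show ?thesis using gA indA'[OF g] E[OF g] unfolding E2_def P_def by blast
      next
        case False
        then obtain y where y: "y \<in> g" "y \<notin> W" by blast
        obtain x where x: "g = {y, x}" using conjunct2[OF E[OF g]] y(1) by (rule doubletonE)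
        \<comment> \<open>An edge with both ends outside \<open>W\<close> could simply be added to
          \<open>M\<close>.\<close>
        have xW: "x \<in> W"
        proof (rule ccontr)
          assume "x \<notin> W"
          then have d: "g \<inter> \<Union>M = {}" using x y unfolding W_def by blast
          then have "g \<notin> M" using x by blast
          then have "card (insert g M) = Suc (card M)" using finM by simp
          moreover have "card (insert g M) \<le> card M"
            by (rule max) (use g M matching_insert[OF M(2) d] in auto)
          ultimately show False by simp
        qed
        have yx: "y \<in> out x" using x g y by (auto simp: out_def insert_commute)
        then have "x \<notin> A'" using outA' by blast
        moreover have "x \<notin> A" using gA x by blast
        ultimately have "x \<in> B" using WB xW by blast
        then show ?thesis using yx x unfolding E3_def by (auto simp: insert_commute)
      qed
    qed
  qed
  have c1: "card E1 \<le> p * D"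
  proof -
    have "card E1 \<le> (\<Sum>x\<in>A. card {e \<in> E. x \<in> e})"
      unfolding E1_def by (rule card_UN_le) (use finAB in auto)
    also have "\<dots> \<le> (\<Sum>x\<in>A. D)"
      by (rule sum_mono) (use deg AW E M(1) W_def in blast)
    finally show ?thesis using cA by simp
  qed
  have c3: "card E3 \<le> 2 * (m - p)"
  proof -
    have "card E3 \<le> (\<Sum>x\<in>B. card ((\<lambda>y. {x, y}) ` out x))"
      unfolding E3_def by (rule card_UN_le) (use finAB in auto)
    also have "\<dots> \<le> (\<Sum>x\<in>B. 1)"
      by (intro sum_mono le_trans[OF card_image_le[OF finout] outB])
    finally show ?thesis using cB by simp
  qed
  have c2: "2 * card E2 + p * (p - 1) = (2 * m - p) * (2 * m - p - 1)"
  proof -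
    have "A' \<subseteq> W - A" using AW AA' by blast
    then have "P A' \<subseteq> P (W - A)" unfolding P_def by blast
    then have "card E2 + card (P A') = card (P (W - A))"
      unfolding E2_def using finP finAB finW
      by (metis card_Diff_subset card_mono finite_Diff le_add_diff_inverse2)
    moreover have "2 * card (P A') = p * (p - 1)"
      unfolding P_def using card_pairs[OF finAB(2)] cA by simp
    moreover have "card (W - A) = 2 * m - p"
      using AW finAB cA cW by (simp add: card_Diff_subset m_def)
    then have "2 * card (P (W - A)) = (2 * m - p) * (2 * m - p - 1)"
      unfolding P_def using card_pairs[of "W - A"] finW by simp
    ultimately show ?thesis by linarith
  qed
  have "card E \<le> card E1 + card E2 + card E3"
  proof -
    have "finite E1" "finite E2" "finite E3"
      unfolding E1_def E2_def E3_def using finE finAB finP finW finout by auto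
    then have "card E \<le> card (E1 \<union> E2 \<union> E3)" using sub by (intro card_mono) auto
    also have "\<dots> \<le> card (E1 \<union> E2) + card E3" by (rule card_Un_le)
    also have "card (E1 \<union> E2) \<le> card E1 + card E2" by (rule card_Un_le)
    finally show ?thesis by simp
  qed
  then have tot: "card E \<le> p * D + card E2 + 2 * (m - p)" using c1 c3 by linarith
  \<comment> \<open>Here k is the number of matching edges outside \<open>MA\<close>. The difference
    of binomials becomes 2 k m - k, so the three bounds sum to at most p D + 2 k m + k, and 2 m <= D
    turns this into at most m D + k.\<close>
  obtain k where k: "m = p + k" using pm le_Suc_ex by blast
  have i2: "card E2 = k * (2 * p + 2 * k) - k"
  proof -
    have "2 * int (card E2) + int p * (int p - 1) = (int p + 2 * int k) * (int p + 2 * int k - 1)"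
    proof -
      have "int (p * (p - 1)) = int p * (int p - 1)" by (rule int_mult_pred)
      moreover have "int ((p + 2 * k) * (p + 2 * k - 1)) = (int p + 2 * int k) * (int p + 2 * int k - 1)"
        using int_mult_pred[of "p + 2 * k"] by simp
      moreover have "2 * m - p = p + 2 * k" using k by simp
      ultimately show ?thesis using c2 by (metis of_nat_add of_nat_mult of_nat_numeral)
    qed
    then have "int (card E2) = int (k * (2 * p + 2 * k)) - int k" by (simp add: algebra_simps)
    then show ?thesis by linarith
  qed
  have D': "2 * p + 2 * k \<le> D" using D k m_def by simp
  have "card E2 + 2 * k \<le> k * (2 * p + 2 * k) + k"
    using i2 by (cases "k = 0") auto
  also have "\<dots> \<le> k * D + k" using D' by simp
  finally show ?thesis using tot k by (simp add: m_def[symmetric] algebra_simps)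
qed

text \<open>A vertex of degree above \<open>2 k\<close> can extend any matching of size \<open>k\<close> that avoids it, so deleting it
  lowers the matching number; without such vertices the preceding bound applies.\<close>

theorem Erdos_Gallai_matching:
  fixes E :: "'a set set"
  assumes "finite V" and "\<And>e. e \<in> E \<Longrightarrow> e \<subseteq> V \<and> card e = 2"
    and "\<And>M. M \<subseteq> E \<Longrightarrow> matching M \<Longrightarrow> card M \<le> k"
  shows "card E \<le> k * (2 * k + 1) \<or>
    2 * int (card E) \<le> int k * (2 * int (card V) - int k - 1)"
  using assms
proof (induction k arbitrary: V E)
  case 0
  have "E = {}"
  proof (rule ccontr)
    assume "E \<noteq> {}"
    then obtain e where "e \<in> E" by blast
    then show False using "0.prems"(3)[of "{e}"] by (simp add: matching_def)
  qed
  then show ?case by simp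
next
  case (Suc k)
  note V = Suc.prems(1) and E = Suc.prems(2) and nu = Suc.prems(3)
  have finE: "finite E" using E V by (intro finite_subset[of E "Pow V"]) auto
  show ?case
  proof (cases "\<exists>v\<in>V. card {e \<in> E. v \<in> e} > 2 * Suc k")
    case True
    then obtain v where v: "v \<in> V" "card {e \<in> E. v \<in> e} > 2 * Suc k" by blast
    define E' where "E' = {e \<in> E. v \<notin> e}"
    have E': "e \<subseteq> V - {v} \<and> card e = 2" if "e \<in> E'" for e using that E by (auto simp: E'_def)
    have nu': "card M \<le> k" if M: "M \<subseteq> E'" "matching M" for M
    proof (rule ccontr)
      assume "\<not> card M \<le> k"
      moreover have "card M \<le> Suc k" using nu[of M] M by (auto simp: E'_def)
      ultimately have cM: "card M = Suc k" by simp
      then have finM: "finite M" using card.infinite by fastforce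
      have cU: "card (\<Union>M) = 2 * Suc k"
        using card_Union_matching[OF M(2) finM] E' M(1) cM by (metis subsetD)
      then have finU: "finite (\<Union>M)" by (metis card.infinite mult_is_0 nat.distinct(1) zero_neq_numeral)
      have "\<exists>e\<in>{e \<in> E. v \<in> e}. e \<inter> \<Union>M = {}"
      proof (rule ccontr)
        assume neg: "\<not> ?thesis"
        have "{e \<in> E. v \<in> e} \<subseteq> (\<lambda>w. {v, w}) ` \<Union>M"
        proof
          fix e assume e: "e \<in> {e \<in> E. v \<in> e}"
          then have "card e = 2" "v \<in> e" using E by auto
          then obtain w where w: "e = {v, w}" by (rule doubletonE)
          have "v \<notin> \<Union>M" using M(1) by (auto simp: E'_def)
          moreover have "e \<inter> \<Union>M \<noteq> {}" using neg e by blast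
          ultimately have "w \<in> \<Union>M" unfolding w by auto
          then show "e \<in> (\<lambda>w. {v, w}) ` \<Union>M" using w by blast
        qed
        then have "card {e \<in> E. v \<in> e} \<le> card (\<Union>M)"
          by (meson card_image_le card_mono finU finite_imageI le_trans)
        then show False using v cU by simp
      qed
      then obtain e where e: "e \<in> E" "v \<in> e" "e \<inter> \<Union>M = {}" by blast
      then have "e \<notin> M" by blast
      then have "card (insert e M) = Suc (Suc k)" using finM cM by simp
      moreover have "card (insert e M) \<le> Suc k"
        by (rule nu) (use e M matching_insert[OF M(2) e(3)] E'_def in auto)
      ultimately show False by simp
    qed
    have IH: "card E' \<le> k * (2 * k + 1) \<or>
        2 * int (card E') \<le> int k * (2 * int (card (V - {v})) - int k - 1)"
      by (rule Suc.IH) (use V E' nu' in blast)+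
    have cV: "int (card (V - {v})) = int (card V) - 1"
      using v(1) V by (metis card_Suc_Diff1 of_nat_Suc add_diff_cancel_left')
    have "{e \<in> E. v \<in> e} \<subseteq> (\<lambda>w. {v, w}) ` (V - {v})"
    proof
      fix e assume e: "e \<in> {e \<in> E. v \<in> e}"
      then have "card e = 2" "v \<in> e" using E by auto
      then obtain w where w: "e = {v, w}" "v \<noteq> w" by (rule doubletonE)
      then show "e \<in> (\<lambda>w. {v, w}) ` (V - {v})" using e E by blast
    qed
    then have "card {e \<in> E. v \<in> e} \<le> card (V - {v})"
      by (meson V card_image_le card_mono finite_Diff finite_imageI le_trans)
    moreover have "card E = card {e \<in> E. v \<in> e} + card E'"
    proof -
      have "E = {e \<in> E. v \<in> e} \<union> E'" "{e \<in> E. v \<in> e} \<inter> E' = {}" by (auto simp: E'_def)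
      then show ?thesis using finE by (metis card_Un_disjoint finite_Un)
    qed
    ultimately have cE: "int (card E) \<le> int (card V) - 1 + int (card E')" using cV by linarith
    define a where "a = int (card V)"
    define x where "x = int k"
    have x0: "x \<ge> 0" by (simp add: x_def)
    show ?thesis
    proof (cases "2 * int (card E') \<le> int k * (2 * int (card (V - {v})) - int k - 1)")
      case True
      then have "2 * int (card E) \<le> 2 * (a - 1) + x * (2 * (a - 1) - x - 1)"
        using cE cV by (simp add: a_def x_def)
      also have "\<dots> = (x + 1) * (2 * a - (x + 1) - 1)" by (simp add: algebra_simps)
      finally show ?thesis by (simp add: a_def x_def add.commute)
    next
      case False
      then have "card E' \<le> k * (2 * k + 1)" using IH by blast
      then have "int (card E') \<le> int (k * (2 * k + 1))" by (simp only: of_nat_le_iff)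
      then have E'k: "int (card E') \<le> x * (2 * x + 1)" by (simp add: x_def algebra_simps)
      \<comment> \<open>From x to x + 1 the bound x (2 x + 1) grows by exactly 4 x + 3, which
        absorbs the at most a - 1 edges at v as long as a <= 4 x + 4. For larger a the other
        alternative is already large enough.\<close>
      show ?thesis
      proof (cases "a \<le> 4 * x + 4")
        case True
        have "int (card E) \<le> (x + 1) * (2 * (x + 1) + 1)"
          using E'k cE True by (simp add: a_def algebra_simps)
        also have "\<dots> = int (Suc k * (2 * Suc k + 1))" by (simp add: x_def algebra_simps)
        finally have "card E \<le> Suc k * (2 * Suc k + 1)" by (simp only: of_nat_le_iff)
        then show ?thesis by (rule disjI1)
      next
        case ak: False
        have "x * (5 * x + 5) \<le> x * (2 * a)" using ak x0 by (intro mult_left_mono) auto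
        then have "2 * int (card E) \<le> (x + 1) * (2 * a - (x + 1) - 1)"
          using E'k cE x0 by (simp add: a_def algebra_simps)
        then show ?thesis by (simp add: a_def x_def add.commute)
      qed
    qed
  next
    case False
    \<comment> \<open>The edge bound needs a matching of maximum size, which may be smaller than
      \<open>Suc k\<close>; the degree bound 2 (k + 1) is still at least twice that size.\<close>
    define \<nu> where "\<nu> = Max {card M |M. M \<subseteq> E \<and> matching M}"
    have fin: "finite {card M |M. M \<subseteq> E \<and> matching M}"
      by (rule finite_subset[of _ "card ` Pow E"]) (use finE in auto)
    have "\<nu> \<in> {card M |M. M \<subseteq> E \<and> matching M}" unfolding \<nu>_def
      by (rule Max_in[OF fin]) (auto simp: matching_def intro!: exI[of _ "{}"])
    then obtain M where M: "M \<subseteq> E" "matching M" "card M = \<nu>" by blast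
    have max: "card N \<le> card M" if "N \<subseteq> E" "matching N" for N
      unfolding M(3) \<nu>_def by (rule Max_ge[OF fin]) (use that in blast)
    have Mk: "card M \<le> Suc k" using nu[OF M(1,2)] .
    have "card E \<le> card M * (2 * Suc k + 1)"
      by (rule maximum_matching_edge_bound[OF V E M(1,2) max])
        (use False Mk in \<open>auto simp: not_less\<close>)
    also have "\<dots> \<le> Suc k * (2 * Suc k + 1)" by (rule mult_le_mono1[OF Mk])
    finally show ?thesis by blast
  qed
qed

section \<open>Cover-free families and the pairs owned by one member\<close>

definition cover_free :: "nat \<Rightarrow> 'a set set \<Rightarrow> bool" where
  "cover_free d F \<longleftrightarrow> (\<forall>A\<in>F. \<forall>G. G \<subseteq> F - {A} \<and> finite G \<and> card G \<le> d \<longrightarrow> \<not> A \<subseteq> \<Union>G)"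

lemma cover_freeD:
  "cover_free d F \<Longrightarrow> A \<in> F \<Longrightarrow> G \<subseteq> F - {A} \<Longrightarrow> finite G \<Longrightarrow> card G \<le> d \<Longrightarrow> A \<subseteq> \<Union>G \<Longrightarrow> False"
  unfolding cover_free_def by blast

text \<open>These are the own subsets of size two in the sense of Erdos, Frankl and Furedi. Distinct
  members of \<open>F\<close> own disjoint sets of pairs, which makes them countable against all
  pairs of the ground set.\<close>

definition own_pairs :: "'a set set \<Rightarrow> 'a set \<Rightarrow> 'a set set" where
  "own_pairs F A = {e. e \<subseteq> A \<and> card e = 2 \<and> (\<forall>B\<in>F. e \<subseteq> B \<longrightarrow> B = A)}"

text \<open>One other set covers each matching edge and one other set covers each remaining point.
  This covers \<open>A\<close> by at most |M| + (|A| - 2 |M|) = |A| - |M| sets, so that number must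
  exceed d.\<close>

lemma cover_free_shared_matching:
  assumes cf: "cover_free d F" and A: "A \<in> F" "finite A"
    and shared: "\<And>x. x \<in> A \<Longrightarrow> \<exists>B\<in>F - {A}. x \<in> B"
    and M: "matching M" "\<And>e. e \<in> M \<Longrightarrow> e \<subseteq> A \<and> card e = 2" "\<And>e. e \<in> M \<Longrightarrow> \<exists>B\<in>F - {A}. e \<subseteq> B"
  shows "card M + d < card A"
proof (rule ccontr)
  assume neg: "\<not> ?thesis"
  have finM: "finite M" using M(2) A(2) by (intro finite_subset[of M "Pow A"]) auto
  obtain f where f: "\<And>x. x \<in> A \<Longrightarrow> f x \<in> F - {A} \<and> x \<in> f x" using shared by metis
  obtain g where g: "\<And>e. e \<in> M \<Longrightarrow> g e \<in> F - {A} \<and> e \<subseteq> g e" using M(3) by metis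
  let ?R = "A - \<Union>M"
  let ?G = "g ` M \<union> f ` ?R"
  have cU: "card (\<Union>M) = 2 * card M" using card_Union_matching[OF M(1) finM] M(2) by blast
  have UA: "\<Union>M \<subseteq> A" using M(2) by blast
  then have "card ?R = card A - 2 * card M" "2 * card M \<le> card A"
    using cU A(2) card_mono[OF A(2) UA] by (auto simp: card_Diff_subset finite_subset)
  moreover have "card ?G \<le> card M + card ?R"
    by (meson A(2) add_mono card_Un_le card_image_le finM finite_Diff le_trans)
  ultimately have "card ?G \<le> d" using neg by linarith
  moreover have "?G \<subseteq> F - {A}" using f g by blast
  moreover have "finite ?G" using finM A(2) by simp
  moreover have "A \<subseteq> \<Union>?G"
  proof
    fix x assume x: "x \<in> A"
    show "x \<in> \<Union>?G"
    proof (cases "x \<in> \<Union>M")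
      case True then show ?thesis using g by blast
    next
      case False then show ?thesis using f[OF x] x by blast
    qed
  qed
  ultimately show False using cover_freeD[OF cf A(1)] by blast
qed

text \<open>The pairs of \<open>A\<close> shared with another member form a graph without a matching
  of more than k edges; the own pairs are its complement. The alternatives correspond to the two
  Erdos--Gallai extremal graphs: a clique on 2 k + 1 vertices, and all edges meeting k fixed
  vertices. In the latter case the pairs among the other a - k = d + 1 points remain.\<close>

lemma cover_free_own_pairs:
  assumes cf: "cover_free d F" and A: "A \<in> F" "finite A"
    and shared: "\<And>x. x \<in> A \<Longrightarrow> \<exists>B\<in>F - {A}. x \<in> B"
    and a: "a = int (card A)" and k: "k = a - int d - 1"
  shows "k \<ge> 0"
    and "2 * int (card (own_pairs F A)) \<ge> a * (a - 1) - 2 * k * (2 * k + 1) \<or>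
         2 * int (card (own_pairs F A)) \<ge> int d * (int d + 1)"
proof -
  have "card ({} :: 'a set set) + d < card A"
    by (rule cover_free_shared_matching[OF cf A shared]) (auto simp: matching_def)
  then show k0: "k \<ge> 0" using a k by simp
  define E where "E = {e. e \<subseteq> A \<and> card e = 2 \<and> (\<exists>B\<in>F - {A}. e \<subseteq> B)}"
  have "card M \<le> nat k" if "M \<subseteq> E" "matching M" for M
  proof -
    have "card M + d < card A"
      by (rule cover_free_shared_matching[OF cf A shared that(2)]) (use that(1) E_def in auto)
    then show ?thesis using a k by linarith
  qed
  then have EG: "card E \<le> nat k * (2 * nat k + 1) \<or>
      2 * int (card E) \<le> int (nat k) * (2 * int (card A) - int (nat k) - 1)"
    by (intro Erdos_Gallai_matching[OF A(2)]) (auto simp: E_def)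
  have "{e. e \<subseteq> A \<and> card e = 2} = E \<union> own_pairs F A" "E \<inter> own_pairs F A = {}"
    by (auto simp: E_def own_pairs_def)
  moreover have "finite {e. e \<subseteq> A \<and> card e = 2}"
    by (rule finite_subset[of _ "Pow A"]) (use A(2) in auto)
  ultimately have "card {e. e \<subseteq> A \<and> card e = 2} = card E + card (own_pairs F A)"
    by (metis card_Un_disjoint finite_Un)
  moreover have "int (card A * (card A - 1)) = a * (a - 1)"
    unfolding a by (rule int_mult_pred)
  ultimately have tot: "2 * int (card E) + 2 * int (card (own_pairs F A)) = a * (a - 1)"
    using card_pairs[OF A(2)] by linarith
  show "2 * int (card (own_pairs F A)) \<ge> a * (a - 1) - 2 * k * (2 * k + 1) \<or>
         2 * int (card (own_pairs F A)) \<ge> int d * (int d + 1)"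
    using EG
  proof
    assume "card E \<le> nat k * (2 * nat k + 1)"
    then have "int (card E) \<le> int (nat k * (2 * nat k + 1))" by (simp only: of_nat_le_iff)
    then have "int (card E) \<le> k * (2 * k + 1)" using k0 by (simp add: algebra_simps)
    then show ?thesis using tot by linarith
  next
    assume "2 * int (card E) \<le> int (nat k) * (2 * int (card A) - int (nat k) - 1)"
    then have "2 * int (card E) \<le> k * (2 * a - k - 1)" using k0 a by simp
    moreover have "a * (a - 1) - k * (2 * a - k - 1) = int d * (int d + 1)"
      by (simp add: k algebra_simps)
    ultimately show ?thesis using tot by linarith
  qed
qed

section \<open>The constant and the quadratic estimate\<close>

definition cf_const :: real where "cf_const = (15 + sqrt 33) / 24"

lemma cf_const_bounds: "cf_const \<ge> 43 / 50" "cf_const < 1"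
proof -
  have "sqrt 33 \<ge> 57 / 10" by (rule real_le_rsqrt) (simp add: power2_eq_square)
  then show "cf_const \<ge> 43 / 50" by (simp add: cf_const_def)
  have "sqrt 33 < 6" by (rule real_less_lsqrt) auto
  then show "cf_const < 1" by (simp add: cf_const_def)
qed

text \<open>The constant is the larger root of 12 c^2 - 15 c + 4; equivalently 16 c - 12 c^2 - 4 =
  c, the form in which the estimate uses it.\<close>

lemma cf_const_eq: "12 * cf_const\<^sup>2 = 15 * cf_const - 4"
proof -
  have "(sqrt 33)\<^sup>2 = 33" by simp
  then show ?thesis unfolding cf_const_def by (simp add: power2_eq_square field_simps)
qed

text \<open>The left-hand side is concave in \<open>a\<close>. At \<open>a = d + 1\<close> it equals \<open>d (d + 1)\<close>, and at
  \<open>a = 2 c d\<close> its quadratic part is exactly \<open>c d\<^sup>2\<close>: this is the equation that determines the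
  constant \<open>c\<close>.\<close>

lemma own_pairs_bound_estimate:
  fixes a d :: real
  assumes d: "d \<ge> 1" and a: "d + 1 \<le> a" "a \<le> 2 * cf_const * d"
  shows "a * (a - 1) - 2 * (a - d - 1) * (2 * (a - d - 1) + 1) \<ge> cf_const * d\<^sup>2"
proof -
  define c where "c = cf_const"
  define L where "L = (5 - 6 * c) * d + 2"
  have c: "c \<ge> 43 / 50" "c < 1" "12 * c\<^sup>2 = 15 * c - 4"
    using cf_const_bounds cf_const_eq by (simp_all add: c_def)
  have conc: "(a - (d + 1)) * (2 * c * d - a) \<ge> 0" using a by (simp add: c_def)
  \<comment> \<open>The product in \<open>conc\<close> vanishes at both ends of the range of a, so
    what remains is the chord, linear in a with slope \<open>L\<close>. It suffices to check the end
    at which the chord is smaller.\<close>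
  have eq: "a * (a - 1) - 2 * (a - d - 1) * (2 * (a - d - 1) + 1) =
      3 * ((a - (d + 1)) * (2 * c * d - a)) + L * a + 6 * c * d * (d + 1) - 4 * d\<^sup>2 - 6 * d - 2"
    by (simp add: L_def algebra_simps power2_eq_square)
  have "L * a + 6 * c * d * (d + 1) - 4 * d\<^sup>2 - 6 * d - 2 \<ge> c * d\<^sup>2"
  proof (cases "L \<ge> 0")
    case True
    have "L * (d + 1) \<le> L * a" using True a by (intro mult_left_mono) auto
    moreover have "L * (d + 1) + 6 * c * d * (d + 1) - 4 * d\<^sup>2 - 6 * d - 2 = d\<^sup>2 + d"
      by (simp add: L_def algebra_simps power2_eq_square)
    moreover have "c * d\<^sup>2 \<le> 1 * d\<^sup>2" using c by (intro mult_right_mono) auto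
    ultimately show ?thesis using d by linarith
  next
    case False
    have "L * (2 * c * d) \<le> L * a" using False a by (intro mult_left_mono_neg) (auto simp: c_def)
    moreover have "L * (2 * c * d) + 6 * c * d * (d + 1) - 4 * d\<^sup>2 - 6 * d - 2
        = (16 * c - 12 * c\<^sup>2 - 4) * d\<^sup>2 + (10 * c - 6) * d - 2"
      by (simp add: L_def algebra_simps power2_eq_square)
    moreover have "(16 * c - 12 * c\<^sup>2 - 4) = c" using c by simp
    \<comment> \<open>With d >= 1 the surplus over c d^2 is at least 10 c - 8, which is nonnegative
      since c >= 43/50.\<close>
    moreover have "(10 * c - 6) * d \<ge> (10 * c - 6) * 1" using c d by (intro mult_left_mono) auto
    ultimately show ?thesis using c by (simp add: algebra_simps)
  qed
  then show ?thesis using eq conc by (simp add: c_def)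
qed

section \<open>Double counting and the induction on the ground set\<close>

lemma own_pairs_sum_le:
  assumes "finite S" "F \<subseteq> Pow S"
  shows "2 * (\<Sum>A\<in>F. card (own_pairs F A)) \<le> card S * (card S - 1)"
proof -
  have finF: "finite F" using assms finite_subset by blast
  have sub: "(\<Union>A\<in>F. own_pairs F A) \<subseteq> {e. e \<subseteq> S \<and> card e = 2}"
    using assms(2) by (auto simp: own_pairs_def)
  have fin: "finite {e. e \<subseteq> S \<and> card e = 2}"
    by (rule finite_subset[of _ "Pow S"]) (use assms in auto)
  have "(\<Sum>A\<in>F. card (own_pairs F A)) = card (\<Union>A\<in>F. own_pairs F A)"
  proof (rule card_UN_disjoint[symmetric, OF finF])
    show "\<forall>A\<in>F. finite (own_pairs F A)"
    proof
      fix A assume "A \<in> F"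
      then have "own_pairs F A \<subseteq> {e. e \<subseteq> S \<and> card e = 2}" using sub by blast
      then show "finite (own_pairs F A)" using fin by (rule finite_subset)
    qed
    show "\<forall>A\<in>F. \<forall>B\<in>F. A \<noteq> B \<longrightarrow> own_pairs F A \<inter> own_pairs F B = {}"
      unfolding own_pairs_def by blast
  qed
  also have "\<dots> \<le> card {e. e \<subseteq> S \<and> card e = 2}" by (rule card_mono[OF fin sub])
  finally show ?thesis using card_pairs[OF assms(1)] by linarith
qed

lemma cover_free_subset: "cover_free d F \<Longrightarrow> F' \<subseteq> F \<Longrightarrow> cover_free d F'"
  unfolding cover_free_def by blast

text \<open>A cover of B - A by d traces, enlarged by \<open>A\<close> itself, lifts to a cover of B
  by d + 1 sets. If B and B' had the same trace, then \<open>A\<close> and B' would cover B; d >= 1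
  permits this two-set cover.\<close>

lemma cover_free_remove_set:
  assumes cf: "cover_free (Suc d) F" and A: "A \<in> F" and d: "d \<ge> 1"
  shows "cover_free d ((\<lambda>B. B - A) ` (F - {A}))" and "inj_on (\<lambda>B. B - A) (F - {A})"
proof -
  show inj: "inj_on (\<lambda>B. B - A) (F - {A})"
  proof (rule inj_onI, rule ccontr)
    fix B B' assume B: "B \<in> F - {A}" "B' \<in> F - {A}" "B - A = B' - A" "B \<noteq> B'"
    have "card {A, B'} \<le> Suc d" using d card_insert_le_m1[of 2 "{B'}" A] by simp
    moreover have "B \<subseteq> \<Union>{A, B'}" using B(3) by blast
    ultimately show False using cover_freeD[OF cf, of B "{A, B'}"] B A by auto
  qed
  show "cover_free d ((\<lambda>B. B - A) ` (F - {A}))"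
    unfolding cover_free_def
  proof (intro ballI allI impI notI, elim conjE)
    fix B' G assume "B' \<in> (\<lambda>B. B - A) ` (F - {A})"
      and G: "G \<subseteq> (\<lambda>B. B - A) ` (F - {A}) - {B'}" "finite G" "card G \<le> d" "B' \<subseteq> \<Union>G"
    then obtain B where B: "B \<in> F" "B \<noteq> A" "B' = B - A" by blast
    from G(1) have "G \<subseteq> (\<lambda>B. B - A) ` (F - {A})" by blast
    then obtain H where H: "H \<subseteq> F - {A}" "G = (\<lambda>B. B - A) ` H" by (auto simp: subset_image_iff)
    have "inj_on (\<lambda>B. B - A) H" using inj H(1) by (rule inj_on_subset)
    then have "finite H" "card H = card G" using H(2) G(2) by (auto simp: finite_image_iff card_image)
    then have "finite (insert A H)" "card (insert A H) \<le> Suc d"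
      using G(3) by (auto simp: card_insert_if)
    moreover have "insert A H \<subseteq> F - {B}" using H G(1) B A by blast
    moreover have "B \<subseteq> \<Union>(insert A H)" using G(4) H(2) B(3) by blast
    ultimately show False using cover_freeD[OF cf B(1)] by blast
  qed
qed

text \<open>Describing F exactly, instead of only bounding its size, drives the induction: the
  smaller family has a known size, which contradicts \<open>large\<close>, or known members, which
  determine the set that was removed.\<close>

theorem cover_free_eq_singletons:
  fixes F :: "'a set set"
  assumes "finite S" "F \<subseteq> Pow S" "cover_free d F"
    and "real (card S) < cf_const * (real d)\<^sup>2" "card S \<le> card F"
  shows "F = (\<lambda>x. {x}) ` S"
  using assms
proof (induction "card S" arbitrary: S F d rule: less_induct)
  case less
  note S = less.prems(1) and FS = less.prems(2) and cf = less.prems(3)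
    and small = less.prems(4) and large = less.prems(5)
  have finF: "finite F" using FS S finite_subset by blast
  have d1: "d \<ge> 1" using small by (cases d) auto
  have csing: "card ((\<lambda>x. {x}) ` T) = card T" for T :: "'a set" by (simp add: card_image)
  consider (empty) "S = {}"
    | (unused) x where "x \<in> S" "\<And>A. A \<in> F \<Longrightarrow> x \<notin> A"
    | (owned) x A where "x \<in> S" "A \<in> F" "x \<in> A" "\<And>B. B \<in> F - {A} \<Longrightarrow> x \<notin> B"
    | (shared) "S \<noteq> {}" "\<And>x A. A \<in> F \<Longrightarrow> x \<in> A \<Longrightarrow> \<exists>B\<in>F - {A}. x \<in> B"
  proof -
    have "(\<exists>x\<in>S. \<forall>A\<in>F. x \<notin> A) \<or> (\<exists>x\<in>S. \<exists>A\<in>F. x \<in> A \<and> (\<forall>B\<in>F - {A}. x \<notin> B)) \<or>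
        (\<forall>A\<in>F. \<forall>x\<in>A. \<exists>B\<in>F - {A}. x \<in> B)"
      using FS by (meson PowD subsetD)
    then show thesis using that by metis
  qed
  then show ?case
  proof cases
    case empty
    have "{} \<notin> F" using cover_freeD[OF cf, of "{}" "{}"] by auto
    then show ?thesis using FS empty by auto
  next
    case unused
    have cS: "card (S - {x}) < card S" using unused(1) S by (rule card_Diff1_less[rotated])
    have "F = (\<lambda>x. {x}) ` (S - {x})"
      by (rule less.hyps[OF cS _ _ cf]) (use S FS unused cS small large in auto)
    then have "card F = card (S - {x})" using csing by metis
    then show ?thesis using cS large by simp
  next
    case owned
    have cS: "card (S - {x}) < card S" using owned(1) S by (rule card_Diff1_less[rotated])
    have FA: "F - {A} = (\<lambda>x. {x}) ` (S - {x})"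
    proof (rule less.hyps[OF cS])
      show "F - {A} \<subseteq> Pow (S - {x})" using FS owned by blast
      show "cover_free d (F - {A})" using cf by (rule cover_free_subset) blast
      show "card (S - {x}) \<le> card (F - {A})" using owned(1,2) large S finF by simp
      show "real (card (S - {x})) < cf_const * (real d)\<^sup>2" using cS small by linarith
    qed (use S in simp)
    \<comment> \<open>Any further point y of \<open>A\<close> would have its singleton in F, and
      \<open>A\<close> alone would cover that singleton.\<close>
    have "A \<subseteq> {x}"
    proof
      fix y assume y: "y \<in> A"
      show "y \<in> {x}"
      proof (rule ccontr)
        assume "y \<notin> {x}"
        then have "y \<in> S - {x}" using y owned(2) FS by blast
        then have "{y} \<in> F - {A}" unfolding FA by (rule imageI)
        then have "{y} \<in> F" "A \<in> F - {{y}}" using owned(2) by auto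
        then show False using cover_freeD[OF cf, of "{y}" "{A}"] y d1 by simp
      qed
    qed
    then have "A = {x}" using owned(3) by blast
    then have "F = insert {x} ((\<lambda>x. {x}) ` (S - {x}))" unfolding FA[symmetric] using owned(2) by auto
    also have "\<dots> = (\<lambda>x. {x}) ` S" using owned(1) by auto
    finally show ?thesis .
  next
    case shared
    have n0: "card S > 0" using shared(1) S by (simp add: card_gt_0_iff)
    have finA: "finite A" if "A \<in> F" for A using that FS S finite_subset by blast
    have False
    proof (cases "\<exists>A\<in>F. real (card A) \<ge> 2 * cf_const * real d")
      case True
      then obtain A where A: "A \<in> F" "real (card A) \<ge> 2 * cf_const * real d" by blast
      \<comment> \<open>For d = 1 the size bound and c < 1 would force \<open>S\<close> to be
        empty.\<close>
      have "d \<noteq> 1" using small n0 cf_const_bounds by auto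
      then obtain b where b: "d = Suc b" "b \<ge> 1" using d1 by (cases d) auto
      define F' where "F' = (\<lambda>B. B - A) ` (F - {A})"
      note rem = cover_free_remove_set[OF cf[unfolded b(1)] A(1) b(2)]
      have cF': "card F' = card F - 1" unfolding F'_def using card_image[OF rem(2)] A(1) finF by simp
      have AS: "A \<subseteq> S" using FS A(1) by blast
      have cSA: "card (S - A) = card S - card A" "card A \<le> card S"
        using card_Diff_subset[OF finA[OF A(1)] AS] card_mono[OF S AS] by auto
      have "2 * cf_const * real d \<ge> 2 * (43/50) * 2"
        using cf_const_bounds b by (intro mult_mono) auto
      then have cA2: "card A \<ge> 2" using A(2) by linarith
      \<comment> \<open>The points lost number at least 2 c d, and c d^2 - 2 c d <= c (d - 1)^2, so
        the induction hypothesis applies with d - 1. But only one set is lost against at least two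
        points, so the smaller family has too many members to consist of singletons.\<close>
      have "F' = (\<lambda>x. {x}) ` (S - A)"
      proof (rule less.hyps)
        show "card (S - A) < card S" using cSA cA2 n0 by simp
        show "F' \<subseteq> Pow (S - A)" using FS unfolding F'_def by blast
        show "cover_free b F'" using rem(1) unfolding F'_def .
        show "card (S - A) \<le> card F'" using cSA cA2 cF' large by linarith
        have "real (card (S - A)) = real (card S) - real (card A)" using cSA by simp
        also have "\<dots> < cf_const * (real d)\<^sup>2 - 2 * cf_const * real d" using small A(2) by linarith
        also have "\<dots> \<le> cf_const * (real b)\<^sup>2"
          using cf_const_bounds b by (simp add: power2_eq_square algebra_simps)
        finally show "real (card (S - A)) < cf_const * (real b)\<^sup>2" .
      qed (use S in auto)
      then have "card F' = card (S - A)" using csing by metis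
      then show False using cF' large cSA cA2 by linarith
    next
      case False
      have own: "2 * card (own_pairs F A) \<ge> card S" if A: "A \<in> F" for A
      proof -
        define a where "a = int (card A)"
        define k where "k = a - int d - 1"
        note o = cover_free_own_pairs[OF cf A finA[OF A] shared(2)[OF A] a_def k_def]
        have ka: "real_of_int k = real_of_int a - real d - 1" by (simp add: k_def)
        have "2 * real (card (own_pairs F A)) \<ge> cf_const * (real d)\<^sup>2"
          using o(2)
        proof
          assume "2 * int (card (own_pairs F A)) \<ge> a * (a - 1) - 2 * k * (2 * k + 1)"
          then have "real_of_int (2 * int (card (own_pairs F A))) \<ge>
              real_of_int (a * (a - 1) - 2 * k * (2 * k + 1))" by (simp only: of_int_le_iff)
          moreover have "real_of_int a * (real_of_int a - 1) -
              2 * (real_of_int a - real d - 1) * (2 * (real_of_int a - real d - 1) + 1)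
              \<ge> cf_const * (real d)\<^sup>2"
          proof (rule own_pairs_bound_estimate)
            show "real d + 1 \<le> real_of_int a" using o(1) ka by linarith
            show "real_of_int a \<le> 2 * cf_const * real d" using False A a_def by fastforce
          qed (use d1 in simp)
          ultimately show ?thesis using ka by simp
        next
          assume "2 * int (card (own_pairs F A)) \<ge> int d * (int d + 1)"
          then have "real_of_int (2 * int (card (own_pairs F A))) \<ge> real_of_int (int d * (int d + 1))"
            by (simp only: of_int_le_iff)
          \<comment> \<open>Since c < 1, the alternative d (d + 1) also exceeds c d^2.\<close>
          moreover have "cf_const * (real d)\<^sup>2 \<le> 1 * (real d)\<^sup>2"
            using cf_const_bounds by (intro mult_right_mono) auto
          ultimately show ?thesis by (simp add: power2_eq_square algebra_simps)
        qed
        then show ?thesis using small by linarith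
      qed
      have "card S * card S \<le> card F * card S" using large by simp
      also have "\<dots> = (\<Sum>A\<in>F. card S)" by simp
      also have "\<dots> \<le> (\<Sum>A\<in>F. 2 * card (own_pairs F A))" by (rule sum_mono) (rule own)
      also have "\<dots> = 2 * (\<Sum>A\<in>F. card (own_pairs F A))" by (simp add: sum_distrib_left)
      also have "\<dots> \<le> card S * (card S - 1)" by (rule own_pairs_sum_le[OF S FS])
      finally show False using n0 by simp
    qed
    then show ?thesis ..
  qed
qed

section \<open>From frameproof codes to cover-free families\<close>

definition diff_positions :: "nat \<Rightarrow> (nat \<Rightarrow> nat) \<Rightarrow> (nat \<Rightarrow> nat) \<Rightarrow> nat set" where
  "diff_positions n c c' = {i \<in> {1..n}. c i \<noteq> c' i}"

text \<open>The undetectable positions of \<open>insert c0 Y\<close> are those outside all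
  difference sets of \<open>Y\<close>. Under a cover, c agrees with c0 on them and so is a
  descendant outside the coalition. The strict bound on |Y| leaves room for c0.\<close>

lemma frameproof_diff_positions_not_covered:
  assumes wf: "wide_sense_frameproof q n t C" and c: "c0 \<in> C" "c \<in> C" "c \<noteq> c0"
    and Y: "Y \<subseteq> C - {c}" "finite Y" "card Y < t"
  shows "\<not> diff_positions n c0 c \<subseteq> (\<Union>y\<in>Y. diff_positions n c0 y)"
proof
  assume cov: "diff_positions n c0 c \<subseteq> (\<Union>y\<in>Y. diff_positions n c0 y)"
  let ?X = "insert c0 Y"
  have "card ?X \<le> t" using Y by (simp add: card_insert_if)
  moreover have "?X \<noteq> {}" "?X \<subseteq> C" using c Y by auto
  ultimately have X: "wdesc q n ?X \<inter> C = ?X" using wf unfolding wide_sense_frameproof_def by simp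
  have "c i = x i" if i: "i \<in> undetectable n ?X" and x: "x \<in> ?X" for i x
  proof -
    have same: "i \<in> {1..n}" "\<And>y. y \<in> ?X \<Longrightarrow> c0 i = y i" using i unfolding undetectable_def by blast+
    then have "i \<notin> (\<Union>y\<in>Y. diff_positions n c0 y)" by (simp add: diff_positions_def)
    then have "c0 i = c i" using cov same(1) by (auto simp: diff_positions_def)
    then show ?thesis using same(2)[OF x] by simp
  qed
  moreover have "c \<in> words q n" using wf c unfolding wide_sense_frameproof_def by blast
  ultimately have "c \<in> wdesc q n ?X" unfolding wdesc_def by blast
  then show False using X c Y by blast
qed

text \<open>Equal difference sets would be a cover by one set, so t >= 2 gives injectivity. Hence a
  cover by difference sets comes from equally many codewords, and adding c0 to t - 1 of them gives a
  coalition of size at most t.\<close>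

lemma frameproof_diff_positions:
  assumes wf: "wide_sense_frameproof q n t C" and t: "t \<ge> 2" and c0: "c0 \<in> C"
  defines "F \<equiv> diff_positions n c0 ` (C - {c0})"
  shows "cover_free (t - 1) F" and "inj_on (diff_positions n c0) (C - {c0})"
proof -
  show inj: "inj_on (diff_positions n c0) (C - {c0})"
  proof (rule inj_onI, rule ccontr)
    fix c c' assume c: "c \<in> C - {c0}" "c' \<in> C - {c0}" "c \<noteq> c'"
      and eq: "diff_positions n c0 c = diff_positions n c0 c'"
    have "\<not> diff_positions n c0 c \<subseteq> (\<Union>y\<in>{c'}. diff_positions n c0 y)"
      by (rule frameproof_diff_positions_not_covered[OF wf c0]) (use c t in auto)
    then show False using eq by simp
  qed
  show "cover_free (t - 1) F"
    unfolding cover_free_def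
  proof (intro ballI allI impI notI, elim conjE)
    fix A G assume A: "A \<in> F"
      and G: "G \<subseteq> F - {A}" "finite G" "card G \<le> t - 1" "A \<subseteq> \<Union>G"
    then obtain c where c: "c \<in> C" "c \<noteq> c0" "A = diff_positions n c0 c" unfolding F_def by blast
    from G(1) have "G \<subseteq> diff_positions n c0 ` (C - {c0})" unfolding F_def by blast
    then obtain Y where Y: "Y \<subseteq> C - {c0}" "G = diff_positions n c0 ` Y" by (auto simp: subset_image_iff)
    have "inj_on (diff_positions n c0) Y" using inj Y(1) by (rule inj_on_subset)
    then have "finite Y" "card Y = card G" using Y(2) G(2) by (auto simp: finite_image_iff card_image)
    moreover have "Y \<subseteq> C - {c}" using Y G(1) c by blast
    moreover have "card G < t" using G(3) t by simp
    ultimately have "\<not> A \<subseteq> (\<Union>y\<in>Y. diff_positions n c0 y)"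
      unfolding c(3) using frameproof_diff_positions_not_covered[OF wf c0 c(1,2)] by simp
    then show False using G(4) Y(2) by simp
  qed
qed

lemma frameproof_card_le:
  assumes wf: "wide_sense_frameproof q n t C" and t: "t \<ge> 2" and n: "n \<ge> 2"
    and small: "real n < cf_const * (real t - 1)\<^sup>2"
  shows "card C \<le> n"
proof (rule ccontr)
  assume "\<not> card C \<le> n"
  then have cC: "card C \<ge> Suc n" by simp
  then have finC: "finite C" using card.infinite by fastforce
  \<comment> \<open>Any codeword may serve as the reference word; the contradiction uses this for
    two of them, c0 and c1.\<close>
  have sing: "diff_positions n c ` (C - {c}) = (\<lambda>i. {i}) ` {1..n}" if c: "c \<in> C" for c
  proof (rule cover_free_eq_singletons)
    show "cover_free (t - 1) (diff_positions n c ` (C - {c}))"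
      by (rule frameproof_diff_positions(1)[OF wf t c])
    show "card {1..n} \<le> card (diff_positions n c ` (C - {c}))"
      using card_image[OF frameproof_diff_positions(2)[OF wf t c]] c cC finC by simp
  qed (use small t in \<open>auto simp: diff_positions_def of_nat_diff\<close>)
  obtain c0 where c0: "c0 \<in> C" using cC by fastforce
  have "{1} \<in> diff_positions n c0 ` (C - {c0})" "{2} \<in> diff_positions n c0 ` (C - {c0})"
    unfolding sing[OF c0] using n by auto
  then obtain c1 c2 where c: "c1 \<in> C" "c2 \<in> C" "diff_positions n c0 c1 = {1}" "diff_positions n c0 c2 = {2}"
    by blast
  have mem: "1 \<in> diff_positions n a b \<longleftrightarrow> a 1 \<noteq> b 1" "2 \<in> diff_positions n a b \<longleftrightarrow> a 2 \<noteq> b 2" for a b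
    using n by (simp_all add: diff_positions_def)
  have "c0 1 \<noteq> c1 1" "c0 2 = c1 2" "c0 1 = c2 1" "c0 2 \<noteq> c2 2"
    using mem[of c0 c1] mem[of c0 c2] c(3,4) by simp_all
  \<comment> \<open>Two words that differ from c0 only in position 1 and only in position 2 differ
    from each other in both, while seen from c1 every difference set is a singleton.\<close>
  then have d: "c1 1 \<noteq> c2 1" "c1 2 \<noteq> c2 2" by simp_all
  then have "diff_positions n c1 c2 \<in> diff_positions n c1 ` (C - {c1})" using c(2) by auto
  then obtain i where "diff_positions n c1 c2 = {i}" unfolding sing[OF c(1)] by blast
  moreover have "1 \<in> diff_positions n c1 c2" "2 \<in> diff_positions n c1 c2"
    unfolding mem using d by simp_all
  ultimately show False by simp
qed

theorem theorem1p13: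
  fixes q t n :: nat
  assumes "q \<ge> 2" and "t \<ge> 3" and "n \<ge> 2"
    and "real n < (15 + sqrt 33) / 24 * (real t - 1)\<^sup>2"
  shows "max_frameproof q n t \<le> n"
proof -
  have "card C \<le> n" if "wide_sense_frameproof q n t C" for C
    by (rule frameproof_card_le[OF that]) (use assms in \<open>auto simp: cf_const_def\<close>)
  then show ?thesis
    unfolding max_frameproof_def
    using finite_frameproof_codes[of q n t] wide_sense_frameproof_empty[of q n t]
    by (subst Max_le_iff) auto
qed

end
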